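(* There exists a constant $H>0$ such that the following holds. Let $f:\mathbb{C}\to\mathbb{C}$ be an entire function such that its Newton map $N_f$ has a virtual immediate basin $V$. If $V$ is parabolic of type I, or parabolic of type II, or hyperbolic with constant $h\ge H$, then $0$ is an asymptotic value of $f$ with asymptotic path in $V$; that is, there is a path $\Gamma:(0,\infty)\to V$ with $\lim_{t\to\infty}\Gamma(t)=\infty$ and $\lim_{t\to\infty}f(\Gamma(t))=0$.
   Context: The Newton map of an entire function $f$ is the meromorphic function $N_f:\mathbb{C}\to\widehat{\mathbb{C}}$, $N_f(z)=z-f(z)/f'(z)$. $N_f^{\circ n}$ is the $n$-th iterate; a set $X$ is invariant under a map $N$ if $N(X)\subset X$. Absorbing sets. Let $V$ be a domain invariant under a map $N$. A connected and simply connected open set $A\subset V$ is a weakly absorbing set for $V$ (for $N$) if $N(A)\subset A$ and for each compact $K\subset V$ there is $k\in\mathbb{N}$ with $N^{\circ k}(K)\subset A$. It is an absorbing set if in addition $N(\overline{A})\subset A$, where the closure is taken in $\mathbb{C}$. Virtual immediate basins. A domain $V\subset\mathbb{C}$ is a virtual immediate basin for $N_f$ if it is maximal (among domains in $\mathbb{C}$) with respect to: (1) $\lim_{n\to\infty}N_f^{\circ n}(z)=\infty$ for every $z\in V$; (2) $V$ contains an absorbing set. Types. Let $T(z)=z+1$. A conformal conjugacy for $N_f$ on a virtual immediate basin $V$ is a triple $(\Omega,\phi,T)$ where $\Omega\subset\mathbb{C}$ is a $T$-invariant domain and $\phi:V\to\Omega$ is holomorphic with $\phi\circ N_f=T\circ\phi$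 on $V$, such that there is a weakly absorbing set $A$ for $V$ on which $\phi$ is univalent and for which $\phi(A)$ is a weakly absorbing set for $T|_\Omega$ in $\Omega$. $V$ is parabolic of type I if it has a conformal conjugacy with $\Omega=\mathbb{C}$; parabolic of type II if it has one with $\Omega$ an upper or lower half-plane; hyperbolic with constant $h$ if there is $h>0$ and a conformal conjugacy with $\Omega=S_h=\{z\in\mathbb{C}: |\mathrm{Im}(z)|<h\}$. (By a theorem of Cowen every virtual immediate basin has a conformal conjugacy and is of exactly one of these types, and in the hyperbolic case $h$ is unique.) *)

theory Defs
  imports "HOL-Complex_Analysis.Complex_Analysis"
begin

text \<open>
  The Riemann sphere is \<open>complex option\<close>, where \<open>None\<close> is the point at infinity; its topology is
  the one-point compactification of the plane.
\<close>
definition riemann_sphere :: "complex option topology" where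
  "riemann_sphere = Alexandroff_compactification euclidean"

text \<open>
  For nonconstant entire \<open>f\<close> this is the meromorphic function \<open>z - f z / f' z\<close>. At a zero of \<open>f'\<close>
  that is also a zero of \<open>f\<close>, the quotient \<open>f / f'\<close> has a removable singularity with value 0; any
  other zero of \<open>f'\<close> is a pole. For constant \<open>f\<close>, which has no Newton map, the values are junk:
  constantly \<open>None\<close> or (if \<open>f = 0\<close>) the identity, so that there is no virtual immediate basin.
\<close>
definition newton_map :: "(complex \<Rightarrow> complex) \<Rightarrow> complex \<Rightarrow> complex option" where
  "newton_map f z =
     (if deriv f z \<noteq> 0 then Some (z - f z / deriv f z)
      else if f z = 0 then Some z
      else None)"

text \<open>
  The maps need not be defined at infinity, so an orbit that hits a pole stays at \<open>None\<close> by
  convention. This never happens in an invariant subset of the plane.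
\<close>
primrec iterate :: "(complex \<Rightarrow> complex option) \<Rightarrow> nat \<Rightarrow> complex \<Rightarrow> complex option" where
  "iterate N 0 z = Some z"
| "iterate N (Suc n) z = Option.bind (iterate N n z) N"

definition plane_domain :: "complex set \<Rightarrow> bool" where
  "plane_domain V \<longleftrightarrow> open V \<and> connected V \<and> V \<noteq> {}"

definition invariant_under :: "(complex \<Rightarrow> complex option) \<Rightarrow> complex set \<Rightarrow> bool" where
  "invariant_under N X \<longleftrightarrow> N ` X \<subseteq> Some ` X"

definition weakly_absorbing ::
    "(complex \<Rightarrow> complex option) \<Rightarrow> complex set \<Rightarrow> complex set \<Rightarrow> bool" where
  "weakly_absorbing N V A \<longleftrightarrow>
     plane_domain V \<and> invariant_under N V \<and>
     open A \<and> connected A \<and> simply_connected A \<and> A \<subseteq> V \<and>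
     N ` A \<subseteq> Some ` A \<and>
     (\<forall>K. compact K \<and> K \<subseteq> V \<longrightarrow> (\<exists>k. iterate N k ` K \<subseteq> Some ` A))"

definition absorbing ::
    "(complex \<Rightarrow> complex option) \<Rightarrow> complex set \<Rightarrow> complex set \<Rightarrow> bool" where
  "absorbing N V A \<longleftrightarrow> weakly_absorbing N V A \<and> N ` closure A \<subseteq> Some ` A"

definition escaping_with_absorbing_set ::
    "(complex \<Rightarrow> complex option) \<Rightarrow> complex set \<Rightarrow> bool" where
  "escaping_with_absorbing_set N V \<longleftrightarrow>
     (\<forall>z\<in>V. limitin riemann_sphere (\<lambda>n. iterate N n z) None sequentially) \<and>
     (\<exists>A. absorbing N V A)"

definition virtual_immediate_basin ::
    "(complex \<Rightarrow> complex option) \<Rightarrow> complex set \<Rightarrow> bool" where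
  "virtual_immediate_basin N V \<longleftrightarrow>
     plane_domain V \<and> escaping_with_absorbing_set N V \<and>
     (\<forall>W. plane_domain W \<and> escaping_with_absorbing_set N W \<and> V \<subseteq> W \<longrightarrow> W = V)"

definition unit_translation :: "complex \<Rightarrow> complex option" where
  "unit_translation z = Some (z + 1)"

definition conformal_conjugacy ::
    "(complex \<Rightarrow> complex option) \<Rightarrow> complex set \<Rightarrow> complex set \<Rightarrow> (complex \<Rightarrow> complex) \<Rightarrow> bool" where
  "conformal_conjugacy N V \<Omega> \<phi> \<longleftrightarrow>
     plane_domain \<Omega> \<and> invariant_under unit_translation \<Omega> \<and>
     \<phi> holomorphic_on V \<and> \<phi> ` V \<subseteq> \<Omega> \<and>
     (\<forall>z\<in>V. map_option \<phi> (N z) = unit_translation (\<phi> z)) \<and>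
     (\<exists>A. weakly_absorbing N V A \<and> inj_on \<phi> A \<and>
          weakly_absorbing unit_translation \<Omega> (\<phi> ` A))"

definition parabolic_type_I :: "(complex \<Rightarrow> complex option) \<Rightarrow> complex set \<Rightarrow> bool" where
  "parabolic_type_I N V \<longleftrightarrow> (\<exists>\<phi>. conformal_conjugacy N V UNIV \<phi>)"

text \<open>
  The boundary of the half-plane may be any horizontal line; conjugation by a translation reduces
  this to the real line.
\<close>
definition parabolic_type_II :: "(complex \<Rightarrow> complex option) \<Rightarrow> complex set \<Rightarrow> bool" where
  "parabolic_type_II N V \<longleftrightarrow>
     (\<exists>c \<phi>. conformal_conjugacy N V {z. Im z > c} \<phi> \<or> conformal_conjugacy N V {z. Im z < c} \<phi>)"

definition hyperbolic_with_constant ::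
    "(complex \<Rightarrow> complex option) \<Rightarrow> complex set \<Rightarrow> real \<Rightarrow> bool" where
  "hyperbolic_with_constant N V h \<longleftrightarrow>
     h > 0 \<and> (\<exists>\<phi>. conformal_conjugacy N V {z. \<bar>Im z\<bar> < h} \<phi>)"

definition asymptotic_value_in ::
    "(complex \<Rightarrow> complex) \<Rightarrow> complex \<Rightarrow> complex set \<Rightarrow> bool" where
  "asymptotic_value_in f a V \<longleftrightarrow>
     (\<exists>\<Gamma> :: real \<Rightarrow> complex.
        continuous_on {0<..} \<Gamma> \<and> \<Gamma> ` {0<..} \<subseteq> V \<and>
        filterlim \<Gamma> at_infinity at_top \<and> ((\<lambda>t. f (\<Gamma> t)) \<longlongrightarrow> a) at_top)"

end

theory Submission
  imports Defs "HOL-Real_Asymp.Real_Asymp"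
begin

text \<open>
  Let \<open>\<psi>\<close> be the inverse of \<open>\<phi>\<close> on the absorbing set and \<open>F = f \<circ> \<psi>\<close>. Solving
  \<open>\<psi> (w + 1) = \<psi> w - f (\<psi> w) / f' (\<psi> w)\<close> for \<open>f'\<close> gives \<open>F' / F = - \<psi>' w / (\<psi> (w + 1) - \<psi> w)\<close>.
  Where \<open>\<psi>\<close> is univalent on a large disc around \<open>w\<close>, a distortion estimate puts this quotient near
  \<open>-1\<close>, so \<open>F\<close> decays exponentially along a horizontal ray, whose image under \<open>\<psi>\<close> is the path.
  The size of disc needed is a universal constant, and large discs are available far to the right
  when \<open>\<Omega>\<close> itself contains one. Crude distortion bounds suffice, and Schottky's theorem yields them
  in place of Koebe's theorem.
\<close>

section \<open>The Schwarz lemma on discs and distortion of univalent functions\<close>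

lemma Schwarz_ball:
  fixes f :: "complex \<Rightarrow> complex"
  assumes hol: "f holomorphic_on ball a r" and "r > 0" and fa: "f a = 0"
    and bd: "\<And>z. z \<in> ball a r \<Longrightarrow> norm (f z) < K"
  shows "\<And>z. z \<in> ball a r \<Longrightarrow> norm (f z) \<le> K * norm (z - a) / r"
    and "norm (deriv f a) \<le> K / r"
proof -
  define F where "F = (\<lambda>z. f (a + of_real r * z) / of_real K)"
  have K: "K > 0" using bd[of a] \<open>r > 0\<close> fa by simp
  have im: "a + of_real r * z \<in> ball a r" if "norm z < 1" for z
    using that \<open>r > 0\<close> by (simp add: dist_norm norm_mult)
  have holF: "F holomorphic_on ball 0 1"
  proof -
    have "(f \<circ> (\<lambda>z. a + of_real r * z)) holomorphic_on ball 0 1"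
      by (rule holomorphic_on_compose_gen[OF _ hol])
         (use im in \<open>auto intro!: holomorphic_intros\<close>)
    then show ?thesis
      unfolding F_def o_def using K by (intro holomorphic_intros) auto
  qed
  have F0: "F 0 = 0" by (simp add: F_def fa)
  have F1: "norm (F z) < 1" if "norm z < 1" for z
    using bd[OF im[OF that]] K by (simp add: F_def norm_divide)
  note S = Schwarz_Lemma[OF holF F0 F1]
  show "norm (f z) \<le> K * norm (z - a) / r" if "z \<in> ball a r" for z
  proof -
    define \<xi> where "\<xi> = (z - a) / of_real r"
    have n: "norm \<xi> < 1"
      using that \<open>r > 0\<close> by (simp add: \<xi>_def norm_divide dist_norm norm_minus_commute)
    have "norm (F \<xi>) \<le> norm \<xi>" using S(1) n by blast
    moreover have "a + of_real r * \<xi> = z" using \<open>r > 0\<close> by (simp add: \<xi>_def)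
    moreover have "norm \<xi> = norm (z - a) / r"
      using \<open>r > 0\<close> by (simp add: \<xi>_def norm_divide)
    ultimately show ?thesis
      using K by (simp add: F_def norm_divide field_simps)
  qed
  have "(f has_field_derivative deriv f a) (at (a + of_real r * 0))"
    using holomorphic_derivI[OF hol open_ball, of a] \<open>r > 0\<close> by simp
  then have "((\<lambda>z. f (a + of_real r * z)) has_field_derivative deriv f a * of_real r) (at 0)"
    by (rule DERIV_chain2) (auto intro!: derivative_eq_intros)
  then have "(F has_field_derivative deriv f a * of_real r / of_real K) (at 0)"
    unfolding F_def by (rule DERIV_cdivide)
  then have "deriv F 0 = deriv f a * of_real r / of_real K"
    by (rule DERIV_imp_deriv)
  then have "norm (deriv F 0) = norm (deriv f a) * r / K"
    using K \<open>r > 0\<close> by (simp add: norm_divide norm_mult)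
  moreover have "norm (deriv F 0) \<le> 1" by (rule S(2)[of 0]) auto
  ultimately show "norm (deriv f a) \<le> K / r"
    using K \<open>r > 0\<close> by (simp add: pos_divide_le_eq pos_le_divide_eq)
qed

text \<open>If the image contained the disc of radius \<open>s = 2 * R * norm (deriv g a)\<close>
  about \<open>g a\<close>, the inverse would map that disc into \<open>ball a R\<close>. Schwarz
  would then bound its derivative at \<open>g a\<close> by \<open>R / s\<close>, while the chain
  rule gives exactly \<open>1 / norm (deriv g a)\<close>. The factor 2 turns this into the
  contradiction 1 \<le> 1/2.\<close>

lemma univalent_omitted_value:
  fixes g :: "complex \<Rightarrow> complex"
  assumes hol: "g holomorphic_on ball a R" and inj: "inj_on g (ball a R)" and "R > 0"
  obtains v where "v \<notin> g ` ball a R" "norm (v - g a) < 2 * R * norm (deriv g a)"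
proof -
  define s where "s = 2 * R * norm (deriv g a)"
  have aR: "a \<in> ball a R" using \<open>R > 0\<close> by simp
  have d: "deriv g a \<noteq> 0"
    using holomorphic_injective_imp_regular[OF hol open_ball inj aR] .
  then have s: "s > 0" using \<open>R > 0\<close> by (simp add: s_def)
  have "\<not> ball (g a) s \<subseteq> g ` ball a R"
  proof
    assume sub: "ball (g a) s \<subseteq> g ` ball a R"
    obtain k where k: "k holomorphic_on g ` ball a R"
      "\<And>z. z \<in> ball a R \<Longrightarrow> deriv g z * deriv k (g z) = 1"
      "\<And>z. z \<in> ball a R \<Longrightarrow> k (g z) = z"
      using holomorphic_has_inverse[OF hol open_ball inj] by metis
    have hk: "k holomorphic_on ball (g a) s" using k(1) sub by (rule holomorphic_on_subset)
    have "norm (deriv (\<lambda>y. k y - a) (g a)) \<le> R / s"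
    proof (rule Schwarz_ball(2))
      show "(\<lambda>y. k y - a) holomorphic_on ball (g a) s"
        using hk by (intro holomorphic_intros)
      show "norm (k y - a) < R" if "y \<in> ball (g a) s" for y
        using that sub k(3) by (auto simp: dist_norm norm_minus_commute)
    qed (use s k(3) aR in auto)
    moreover have "deriv (\<lambda>y. k y - a) (g a) = deriv k (g a)"
    proof (rule DERIV_imp_deriv)
      have "(k has_field_derivative deriv k (g a)) (at (g a))"
        using holomorphic_derivI[OF hk open_ball] s by simp
      then show "((\<lambda>y. k y - a) has_field_derivative deriv k (g a)) (at (g a))"
        by (auto intro!: derivative_eq_intros)
    qed
    moreover have "norm (deriv g a) * norm (deriv k (g a)) = 1"
      using k(2)[OF aR] by (metis norm_mult norm_one)
    ultimately have "1 \<le> norm (deriv g a) * (R / s)"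
      by (metis mult_left_mono norm_ge_zero)
    then show False using d \<open>R > 0\<close> by (simp add: s_def)
  qed
  then obtain v where "v \<in> ball (g a) s" "v \<notin> g ` ball a R" by blast
  then show ?thesis using that[of v] by (simp add: s_def dist_norm norm_minus_commute)
qed

text \<open>The bound of Schottky's theorem on the disc of radius 1/2, for a function on the closed
  unit disc that omits 0 and 1 and has modulus at most 1 at the centre.\<close>

definition Schottky_bound :: real where
  "Schottky_bound = exp (pi * exp (pi * (2 + 2 * 1 + 12 * (1/2) / (1 - 1/2))))"

text \<open>The 4 comes from applying Schwarz on a disc of radius \<open>R/4\<close>. The bracket
  bounds \<open>norm (h\<^sup>2 - 1)\<close> when \<open>norm h\<close> is at most
  \<open>Schottky_bound\<close>: one unit is for the triangle inequality, the other makes the bound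
  strict.\<close>

definition growth_const :: real where
  "growth_const = 4 * (Schottky_bound\<^sup>2 + 2)"

lemma growth_const_pos: "growth_const > 0"
  by (simp add: growth_const_def add_nonneg_pos)

text \<open>
  Let \<open>h\<close> be the branch of \<open>sqrt (1 - (g - g a) / (v - g a))\<close> with \<open>h a = 1\<close>. It omits 0 since \<open>v\<close>
  is omitted by \<open>g\<close>, and it omits \<open>-1\<close> since \<open>g\<close> takes the value \<open>g a\<close> only at \<open>a\<close>. So Schottky's
  theorem applies to \<open>-h\<close>.
\<close>
lemma univalent_growth:
  fixes g :: "complex \<Rightarrow> complex"
  assumes hol: "g holomorphic_on ball a R" and inj: "inj_on g (ball a R)" and "R > 0"
    and v: "v \<notin> g ` ball a R" and z: "norm (z - a) < R / 4"
  shows "norm (g z - g a) \<le> growth_const * norm (v - g a) * norm (z - a) / R"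
proof -
  define c where "c = v - g a"
  have aR: "a \<in> ball a R" using \<open>R > 0\<close> by simp
  have c: "c \<noteq> 0" using v aR by (auto simp: c_def)
  define u where "u = (\<lambda>z. 1 - (g z - g a) / c)"
  have holu: "u holomorphic_on ball a R"
    unfolding u_def using c by (intro holomorphic_intros hol) auto
  have unz: "u z \<noteq> 0" if "z \<in> ball a R" for z
  proof
    assume "u z = 0"
    then have "g z = v" using c by (simp add: u_def c_def field_simps)
    then show False using v that by blast
  qed
  obtain h0 where h0: "h0 holomorphic_on ball a R" "\<And>z. z \<in> ball a R \<Longrightarrow> u z = h0 z ^ 2"
    using contractible_imp_holomorphic_sqrt[OF holu convex_imp_contractible[OF convex_ball] unz]
    by metis
  \<comment> \<open>Since \<open>h0 a\<close> is 1 or -1, this factor fixes the sign so that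
    \<open>h a = -1\<close>. This \<open>h\<close> is the negative of the branch in the comment
    above and omits 0 and 1, the values in Schottky's theorem.\<close>
  define h where "h = (\<lambda>z. - h0 z * h0 a)"
  have u_a: "u a = 1" by (simp add: u_def)
  have h0a: "h0 a ^ 2 = 1" using h0(2)[OF aR] u_a by simp
  have hu: "h z ^ 2 = u z" if "z \<in> ball a R" for z
    using h0(2)[OF that] h0a by (simp add: h_def power_mult_distrib)
  have ha: "h a = -1" using h0a by (simp add: h_def power2_eq_square)
  have holh: "h holomorphic_on ball a R"
    unfolding h_def using h0(1) by (intro holomorphic_intros)
  have hnz: "h z \<noteq> 0" if "z \<in> ball a R" for z using hu[OF that] unz[OF that] by auto
  have hn1: "h z \<noteq> 1" if "z \<in> ball a R" for z
  proof
    assume h1: "h z = 1"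
    then have "u z = 1" using hu[OF that] by simp
    then have "g z = g a" using c by (simp add: u_def)
    then have "z = a" using inj that aR by (auto dest: inj_onD)
    then show False using h1 ha by simp
  qed
  \<comment> \<open>Scaling by \<open>R/2\<close> keeps the closed unit disc inside the open ball,
    and points within \<open>R/4\<close> of \<open>a\<close> then correspond to modulus at most
    1/2.\<close>
  have im: "a + of_real (R/2) * \<zeta> \<in> ball a R" if "norm \<zeta> \<le> 1" for \<zeta>
    using mult_left_mono[OF that, of "R/2"] \<open>R > 0\<close> by (simp add: dist_norm norm_mult)
  have bound: "norm (h z) \<le> Schottky_bound" if z: "norm (z - a) < R / 4" for z
  proof -
    define \<xi> where "\<xi> = (z - a) / of_real (R/2)"
    have "norm \<xi> = norm (z - a) / (R/2)"
      unfolding \<xi>_def norm_divide norm_of_real using \<open>R > 0\<close> by simp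
    then have n: "norm \<xi> \<le> 1/2" using z \<open>R > 0\<close> by (simp add: pos_divide_le_eq)
    have "norm ((h \<circ> (\<lambda>\<zeta>. a + of_real (R/2) * \<zeta>)) \<xi>)
      \<le> exp (pi * exp (pi * (2 + 2 * 1 + 12 * (1/2) / (1 - 1/2))))"
    proof (rule Schottky[OF _ _ _ _ _ n])
      show "(h \<circ> (\<lambda>\<zeta>. a + of_real (R/2) * \<zeta>)) holomorphic_on cball 0 1"
        by (rule holomorphic_on_compose_gen[OF _ holh])
           (use im in \<open>auto intro!: holomorphic_intros\<close>)
      show "norm ((h \<circ> (\<lambda>\<zeta>. a + of_real (R/2) * \<zeta>)) 0) \<le> 1" by (simp add: ha)
      show "\<not> ((h \<circ> (\<lambda>\<zeta>. a + of_real (R/2) * \<zeta>)) \<zeta> = 0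
          \<or> (h \<circ> (\<lambda>\<zeta>. a + of_real (R/2) * \<zeta>)) \<zeta> = 1)" if "\<zeta> \<in> cball 0 1" for \<zeta>
        using hnz[OF im[of \<zeta>]] hn1[OF im[of \<zeta>]] that by simp
    qed auto
    moreover have "a + of_real (R/2) * \<xi> = z" using \<open>R > 0\<close> by (simp add: \<xi>_def field_simps)
    ultimately show ?thesis by (simp add: Schottky_bound_def)
  qed
  \<comment> \<open>As \<open>u - 1\<close> vanishes at \<open>a\<close>, Schwarz turns the uniform
    bound into one linear in the distance from \<open>a\<close>.\<close>
  have "norm (u z - 1) \<le> (Schottky_bound\<^sup>2 + 2) * norm (z - a) / (R/4)"
  proof (rule Schwarz_ball(1))
    show "(\<lambda>z. u z - 1) holomorphic_on ball a (R/4)"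
      by (intro holomorphic_intros holomorphic_on_subset[OF holu] subset_ball)
         (use \<open>R > 0\<close> in simp)
    show "norm (u z - 1) < Schottky_bound\<^sup>2 + 2" if z: "z \<in> ball a (R/4)" for z
    proof -
      have z': "z \<in> ball a R" "norm (z - a) < R/4"
        using z \<open>R > 0\<close> by (auto simp: dist_norm norm_minus_commute)
      have "norm (u z - 1) \<le> norm (u z) + 1" by (metis norm_triangle_ineq4 norm_one)
      also have "norm (u z) = norm (h z) ^ 2" using hu[OF z'(1)] by (metis norm_power)
      also have "\<dots> \<le> Schottky_bound\<^sup>2" by (intro power_mono bound z') auto
      finally show ?thesis by simp
    qed
  qed (use \<open>R > 0\<close> u_a z in \<open>auto simp: dist_norm norm_minus_commute\<close>)
  moreover have "norm (u z - 1) = norm (g z - g a) / norm c"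
    by (simp add: u_def norm_divide)
  ultimately have "norm (g z - g a) \<le> ((Schottky_bound\<^sup>2 + 2) * norm (z - a) / (R/4)) * norm c"
    using c by (simp add: divide_le_eq)
  then show ?thesis by (simp add: growth_const_def c_def algebra_simps)
qed

text \<open>The difference quotient \<open>k\<close> at \<open>a\<close> extends holomorphically
  with value \<open>deriv g a\<close>. The growth estimate, with an omitted value close to
  \<open>g a\<close>, bounds it by a multiple of \<open>norm (deriv g a)\<close>. Schwarz for
  \<open>k - deriv g a\<close> then yields one more factor \<open>norm (z - a)\<close>.\<close>

lemma univalent_linear_approximation:
  fixes g :: "complex \<Rightarrow> complex"
  assumes hol: "g holomorphic_on ball a R" and inj: "inj_on g (ball a R)" and "R > 0"
    and z: "norm (z - a) < R / 4"
  shows "norm (g z - g a - deriv g a * (z - a))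
    \<le> 12 * (growth_const + 1) * norm (deriv g a) * (norm (z - a))\<^sup>2 / R"
proof -
  define C where "C = growth_const"
  have C: "C > 0" by (simp add: C_def growth_const_pos)
  obtain v where v: "v \<notin> g ` ball a R" "norm (v - g a) < 2 * R * norm (deriv g a)"
    using univalent_omitted_value[OF hol inj \<open>R > 0\<close>] .
  have aR: "a \<in> ball a R" using \<open>R > 0\<close> by simp
  have d: "deriv g a \<noteq> 0"
    using holomorphic_injective_imp_regular[OF hol open_ball inj aR] .
  define k where "k = (\<lambda>z. if z = a then deriv g a else (g z - g a) / (z - a))"
  have holk: "k holomorphic_on ball a R"
    unfolding k_def by (rule pole_lemma[OF hol]) (use aR in simp)
  have kb: "norm (k z) \<le> (2 * C + 1) * norm (deriv g a)" if z: "norm (z - a) < R/4" for z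
  proof (cases "z = a")
    case True
    then show ?thesis using C by (simp add: k_def mult_le_cancel_right1)
  next
    case False
    have "norm (g z - g a) \<le> C * norm (v - g a) * norm (z - a) / R"
      unfolding C_def by (rule univalent_growth[OF hol inj \<open>R > 0\<close> v(1) z])
    also have "\<dots> \<le> C * (2 * R * norm (deriv g a)) * norm (z - a) / R"
      using v(2) C \<open>R > 0\<close> by (intro divide_right_mono mult_right_mono mult_left_mono) auto
    also have "\<dots> = 2 * C * norm (deriv g a) * norm (z - a)" using \<open>R > 0\<close> by simp
    finally have "norm (k z) \<le> 2 * C * norm (deriv g a)"
      using False by (simp add: k_def norm_divide divide_le_eq)
    then show ?thesis by (simp add: distrib_right add_increasing2)
  qed
  \<comment> \<open>The triangle inequality gives \<open>2 * C + 2\<close>; the larger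
    \<open>3 * C + 3\<close> provides the strict bound that Schwarz requires, and the radius
    \<open>R/4\<close> makes the final constant \<open>12 * (C + 1)\<close>.\<close>
  have "norm (k z - deriv g a) \<le> ((3 * C + 3) * norm (deriv g a)) * norm (z - a) / (R/4)"
  proof (rule Schwarz_ball(1))
    show "(\<lambda>z. k z - deriv g a) holomorphic_on ball a (R/4)"
      by (intro holomorphic_intros holomorphic_on_subset[OF holk] subset_ball)
         (use \<open>R > 0\<close> in simp)
    show "norm (k z - deriv g a) < (3 * C + 3) * norm (deriv g a)" if "z \<in> ball a (R/4)" for z
    proof -
      have "norm (k z - deriv g a) \<le> norm (k z) + norm (deriv g a)" by (rule norm_triangle_ineq4)
      also have "\<dots> \<le> (2 * C + 1) * norm (deriv g a) + norm (deriv g a)"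
        using kb[of z] that by (simp add: dist_norm norm_minus_commute)
      also have "\<dots> < (3 * C + 3) * norm (deriv g a)" using d C by (simp add: distrib_right add_strict_increasing)
      finally show ?thesis .
    qed
  qed (use \<open>R > 0\<close> z in \<open>auto simp: k_def dist_norm norm_minus_commute\<close>)
  moreover have "g z - g a - deriv g a * (z - a) = (k z - deriv g a) * (z - a)"
  proof (cases "z = a")
    case False
    then have "k z * (z - a) = g z - g a" by (simp add: k_def)
    then show ?thesis by (simp only: left_diff_distrib[of "k z"])
  qed simp
  ultimately have "norm (g z - g a - deriv g a * (z - a))
      \<le> ((3 * C + 3) * norm (deriv g a) * norm (z - a) / (R/4)) * norm (z - a)"
    by (simp only: norm_mult) (intro mult_right_mono, auto)
  also have "\<dots> = 12 * (C + 1) * norm (deriv g a) * (norm (z - a))\<^sup>2 / R"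
    by (simp add: power2_eq_square field_simps)
  finally show ?thesis by (simp add: C_def)
qed


section \<open>Unit steps and exponential decay along horizontal rays\<close>

lemma Re_inverse_ge:
  fixes p :: complex
  assumes "norm (p - 1) \<le> 1/2"
  shows "Re (inverse p) \<ge> 2/9"
proof -
  have "\<bar>Re (p - 1)\<bar> \<le> 1/2" using abs_Re_le_cmod[of "p - 1"] assms by linarith
  then have re: "Re p \<ge> 1/2" unfolding minus_complex.sel one_complex.sel by linarith
  have "norm p \<le> 3/2" using norm_triangle_ineq[of "p - 1" 1] assms by simp
  then have "(norm p)\<^sup>2 \<le> (3/2)\<^sup>2" by (intro power_mono) auto
  then have "(norm p)\<^sup>2 \<le> 9/4" by (simp add: power2_eq_square)
  moreover have "(norm p)\<^sup>2 > 0" using re by auto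
  \<comment> \<open>The constant is (1/2) / (3/2)^2, from
    \<open>Re (inverse p) = Re p / (norm p)\<^sup>2\<close>.\<close>
  ultimately have "2/9 \<le> Re p / (norm p)\<^sup>2" using re by (simp add: field_simps)
  then show ?thesis by (simp add: cmod_power2)
qed

text \<open>The least radius for which the linear approximation has relative error at most 1/2 at
  distance 1. It exceeds 24, so a unit step stays within a quarter of the radius, and
  \<open>growth_const / tube_radius\<close> is also at most 1/2.\<close>

definition tube_radius :: real where
  "tube_radius = 24 * (growth_const + 1)"

lemma tube_radius_gt: "tube_radius > 24"
  using growth_const_pos by (simp add: tube_radius_def)

text \<open>The increment over a unit step differs from \<open>deriv \<psi> a\<close> by at most
  half its modulus. The ratio \<open>p\<close> thus lies in the disc of radius 1/2 about 1, and its
  inverse has real part bounded below.\<close>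

lemma step_ratio:
  fixes \<psi> :: "complex \<Rightarrow> complex"
  assumes hol: "\<psi> holomorphic_on ball a R" and inj: "inj_on \<psi> (ball a R)"
    and R: "R \<ge> tube_radius"
  shows "Re (deriv \<psi> a / (\<psi> (a + 1) - \<psi> a)) \<ge> 2/9"
proof -
  have R0: "R > 24" using R tube_radius_gt by linarith
  have d: "deriv \<psi> a \<noteq> 0"
    by (rule holomorphic_injective_imp_regular[OF hol open_ball inj]) (use R0 in simp)
  define p where "p = (\<psi> (a + 1) - \<psi> a) / deriv \<psi> a"
  have "norm (\<psi> (a + 1) - \<psi> a - deriv \<psi> a) \<le> 12 * (growth_const + 1) * norm (deriv \<psi> a) / R"
    using univalent_linear_approximation[OF hol inj, of "a + 1"] R0 by simp
  also have "\<dots> = (12 * (growth_const + 1) / R) * norm (deriv \<psi> a)" by simp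
  also have "\<dots> \<le> (1/2) * norm (deriv \<psi> a)"
    using R R0 by (intro mult_right_mono) (auto simp: tube_radius_def field_simps)
  finally have le: "norm (\<psi> (a + 1) - \<psi> a - deriv \<psi> a) \<le> (1/2) * norm (deriv \<psi> a)" .
  have "p - 1 = (\<psi> (a + 1) - \<psi> a - deriv \<psi> a) / deriv \<psi> a"
    using d by (simp add: p_def diff_divide_distrib)
  then have "norm (p - 1) \<le> 1/2" using le d by (simp add: norm_divide divide_le_eq)
  then have "Re (inverse p) \<ge> 2/9" by (rule Re_inverse_ge)
  then show ?thesis by (simp add: p_def)
qed

lemma exponential_decay:
  fixes G q :: "real \<Rightarrow> complex"
  assumes der: "\<And>t. t \<ge> 0 \<Longrightarrow> (G has_vector_derivative G t * q t) (at t)"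
    and q: "\<And>t. t \<ge> 0 \<Longrightarrow> Re (q t) \<le> - c" and "c > 0"
  shows "(G \<longlongrightarrow> 0) at_top"
proof -
  \<comment> \<open>A Gronwall argument: the weighted quantity is nonincreasing. The squared norm is
    differentiable even at zeros of \<open>G\<close>.\<close>
  define P where "P = (\<lambda>t. (norm (G t))\<^sup>2 * exp (2 * c * t))"
  have derP: "(P has_real_derivative 2 * (norm (G t))\<^sup>2 * exp (2 * c * t) * (Re (q t) + c)) (at t)"
    if "t \<ge> 0" for t
  proof -
    have 1: "((\<lambda>t. Re (G t)) has_real_derivative Re (G t * q t)) (at t)"
      using bounded_linear.has_vector_derivative[OF bounded_linear_Re der[OF that]]
      by (simp add: has_real_derivative_iff_has_vector_derivative)
    have 2: "((\<lambda>t. Im (G t)) has_real_derivative Im (G t * q t)) (at t)"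
      using bounded_linear.has_vector_derivative[OF bounded_linear_Im der[OF that]]
      by (simp add: has_real_derivative_iff_has_vector_derivative)
    show ?thesis
      unfolding P_def cmod_power2
      by (rule derivative_eq_intros 1 2 refl)+
         (simp add: algebra_simps power2_eq_square)
  qed
  have dec: "P t \<le> P 0" if "t \<ge> 0" for t
  proof (rule DERIV_nonpos_imp_nonincreasing[OF that])
    fix x :: real assume "0 \<le> x" "x \<le> t"
    then have "2 * (norm (G x))\<^sup>2 * exp (2 * c * x) * (Re (q x) + c) \<le> 0"
      using q[of x] by (intro mult_nonneg_nonpos) auto
    then show "\<exists>y. DERIV P x :> y \<and> y \<le> 0" using derP[OF \<open>0 \<le> x\<close>] by blast
  qed
  then have le: "(norm (G t))\<^sup>2 \<le> (norm (G 0))\<^sup>2 * exp (- (2 * c) * t)" if "t \<ge> 0" for t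
    using dec[OF that] by (simp add: P_def exp_minus divide_simps mult_ac)
  have "((\<lambda>t::real. exp (- (2 * c) * t)) \<longlongrightarrow> 0) at_top"
    using \<open>c > 0\<close> by real_asymp
  then have lim: "((\<lambda>t. (norm (G 0))\<^sup>2 * exp (- (2 * c) * t)) \<longlongrightarrow> 0) at_top"
    by (rule tendsto_mult_right_zero)
  have "((\<lambda>t. (norm (G t))\<^sup>2) \<longlongrightarrow> 0) at_top"
    by (rule tendsto_sandwich[OF _ _ tendsto_const lim])
       (use le in \<open>auto intro: eventually_mono[OF eventually_ge_at_top[of 0]]\<close>)
  then show ?thesis
    by (simp add: tendsto_norm_zero_iff)
qed

text \<open>Escape is given only at integer times. Between them, the growth estimate with omitted
  value \<open>\<psi> w\<close> bounds the displacement from the last integer point \<open>a\<close>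
  by half of \<open>norm (\<psi> w - \<psi> a)\<close>, so the norm stays above half of
  \<open>norm (\<psi> a) - norm (\<psi> w)\<close>.\<close>

lemma ray_to_infinity:
  fixes \<psi> :: "complex \<Rightarrow> complex"
  assumes hol: "\<psi> holomorphic_on B" and inj: "inj_on \<psi> B" and R: "R \<ge> tube_radius"
    and ball: "\<And>t. t \<ge> 0 \<Longrightarrow> ball (w + of_real t) R \<subseteq> B"
    and lim: "filterlim (\<lambda>n. \<psi> (w + of_nat n)) at_infinity sequentially"
  shows "filterlim (\<lambda>t. \<psi> (w + of_real t)) at_infinity at_top"
proof (rule filterlim_norm_at_top_imp_at_infinity, rule filterlim_at_top_mono)
  have R0: "R > 24" using R tube_radius_gt by linarith
  let ?n = "\<lambda>t::real. nat \<lfloor>t\<rfloor>"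
  let ?l = "\<lambda>t. norm (\<psi> (w + of_nat (?n t)))"
  have "filterlim (\<lambda>n. norm (\<psi> (w + of_nat n))) at_top sequentially"
    using lim by (rule filterlim_at_infinity_imp_norm_at_top)
  moreover have "filterlim ?n sequentially at_top"
    by (rule filterlim_compose[OF filterlim_nat_sequentially filterlim_floor_sequentially])
  ultimately have l: "filterlim ?l at_top at_top" by (rule filterlim_compose)
  show "filterlim (\<lambda>t. - norm (\<psi> w) / 2 + (1/2) * ?l t) at_top at_top"
    by (intro filterlim_tendsto_add_at_top[OF tendsto_const]
          filterlim_tendsto_pos_mult_at_top[OF tendsto_const _ l]) simp
  have "- norm (\<psi> w) / 2 + (1/2) * ?l t \<le> norm (\<psi> (w + of_real t))" if t: "t \<ge> R + 1" for t
  proof -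
    define a where "a = w + of_nat (?n t)"
    have n: "real (?n t) = of_int \<lfloor>t\<rfloor>" using t R0 by simp
    have sub: "ball a R \<subseteq> B" using ball[of "real (?n t)"] by (simp add: a_def)
    have w: "w \<in> B" using ball[of 0] R0 by auto
    \<comment> \<open>From t \<ge> R + 1 the integer part of \<open>t\<close>, which is the distance
      from \<open>w\<close> to \<open>a\<close>, is at least \<open>R\<close>.\<close>
    have "w \<notin> ball a R" using t R0 n by (simp add: a_def dist_norm) linarith
    then have v: "\<psi> w \<notin> \<psi> ` ball a R" using inj w sub by (auto dest: inj_onD)
    have ta: "w + of_real t - a = of_real (t - of_int \<lfloor>t\<rfloor>)"
      by (simp only: a_def n[symmetric] of_real_diff of_real_of_nat_eq) simp
    have s: "norm (w + of_real t - a) \<le> 1"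
      unfolding ta norm_of_real by linarith
    have "norm (\<psi> (w + of_real t) - \<psi> a)
        \<le> growth_const * norm (\<psi> w - \<psi> a) * norm (w + of_real t - a) / R"
      by (rule univalent_growth[OF holomorphic_on_subset[OF hol sub] inj_on_subset[OF inj sub] _ v])
         (use s R0 in auto)
    also have "\<dots> \<le> growth_const * norm (\<psi> w - \<psi> a) * 1 / R"
      using s R0 growth_const_pos by (intro divide_right_mono mult_left_mono) auto
    also have "\<dots> = (growth_const / R) * norm (\<psi> w - \<psi> a)" by simp
    also have "\<dots> \<le> (1/2) * norm (\<psi> w - \<psi> a)"
      using R R0 growth_const_pos
      by (intro mult_right_mono) (auto simp: tube_radius_def field_simps)
    finally have "norm (\<psi> (w + of_real t) - \<psi> a) \<le> norm (\<psi> w - \<psi> a) / 2" by simp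
    moreover have "norm (\<psi> a) \<le> norm (\<psi> (w + of_real t)) + norm (\<psi> (w + of_real t) - \<psi> a)"
      using norm_triangle_sub[of "\<psi> a" "\<psi> (w + of_real t)"] by (simp add: norm_minus_commute)
    moreover have "norm (\<psi> w - \<psi> a) \<le> norm (\<psi> w) + norm (\<psi> a)"
      by (rule norm_triangle_ineq4)
    ultimately show ?thesis by (simp add: a_def)
  qed
  then show "eventually (\<lambda>t. - norm (\<psi> w) / 2 + (1/2) * ?l t \<le> norm (\<psi> (w + of_real t))) at_top"
    by (rule eventually_mono[OF eventually_ge_at_top])
qed

text \<open>The Newton relation becomes a linear equation \<open>G' = G * q\<close> along the ray,
  with \<open>Re q\<close> at most -2/9 by \<open>step_ratio\<close>.\<close>

lemma ray_values_to_zero: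
  fixes f \<psi> :: "complex \<Rightarrow> complex"
  assumes f: "f holomorphic_on UNIV"
    and hol: "\<psi> holomorphic_on B" and inj: "inj_on \<psi> B" and R: "R \<ge> tube_radius"
    and ball: "\<And>t. t \<ge> 0 \<Longrightarrow> ball (w + of_real t) R \<subseteq> B"
    and newton: "\<And>z. z \<in> B \<Longrightarrow> newton_map f (\<psi> z) = Some (\<psi> (z + 1))"
  shows "((\<lambda>t. f (\<psi> (w + of_real t))) \<longlongrightarrow> 0) at_top"
proof (rule exponential_decay)
  have R0: "R > 24" using R tube_radius_gt by linarith
  let ?q = "\<lambda>t::real. - (deriv \<psi> (w + of_real t) /
      (\<psi> (w + of_real t + 1) - \<psi> (w + of_real t)))"
  fix t :: real assume t: "t \<ge> 0"
  define a where "a = w + of_real t"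
  have sub: "ball a R \<subseteq> B" using ball[OF t] by (simp add: a_def)
  note hol' = holomorphic_on_subset[OF hol sub] and inj' = inj_on_subset[OF inj sub]
  have a: "a \<in> ball a R" "a + 1 \<in> ball a R" using R0 by (auto simp: dist_norm)
  have "Re (deriv \<psi> a / (\<psi> (a + 1) - \<psi> a)) \<ge> 2/9" by (rule step_ratio[OF hol' inj' R])
  then show "Re (?q t) \<le> - (2/9)" by (simp add: a_def)
  have ne: "\<psi> (a + 1) \<noteq> \<psi> a" using inj' a by (auto dest: inj_onD)
  have "newton_map f (\<psi> a) = Some (\<psi> (a + 1))" using newton sub a by blast
  \<comment> \<open>The value is finite, which excludes a pole, and differs from
    \<open>\<psi> a\<close>, which excludes the removable case of \<open>newton_map\<close>.\<close>
  then have nz: "deriv f (\<psi> a) \<noteq> 0" and "\<psi> (a + 1) = \<psi> a - f (\<psi> a) / deriv f (\<psi> a)"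
    using ne by (auto simp: newton_map_def split: if_splits)
  then have "f (\<psi> a) = - (deriv f (\<psi> a) * (\<psi> (a + 1) - \<psi> a))" by simp
  then have eq: "deriv f (\<psi> a) * deriv \<psi> a = f (\<psi> a) * - (deriv \<psi> a / (\<psi> (a + 1) - \<psi> a))"
    using ne by simp
  have "(f has_field_derivative deriv f (\<psi> a)) (at (\<psi> a))"
    using holomorphic_derivI[OF f open_UNIV] by simp
  moreover have "(\<psi> has_field_derivative deriv \<psi> a) (at a)"
    using holomorphic_derivI[OF hol' open_ball a(1)] .
  ultimately have "((\<lambda>z. f (\<psi> z)) has_field_derivative deriv f (\<psi> a) * deriv \<psi> a) (at a)"
    by (rule DERIV_chain2)
  moreover have "((\<lambda>t::real. w + of_real t) has_vector_derivative 1) (at t)"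
    by (auto intro!: derivative_eq_intros)
  ultimately have "(((\<lambda>z. f (\<psi> z)) \<circ> (\<lambda>t. w + of_real t)) has_vector_derivative
      1 * (deriv f (\<psi> a) * deriv \<psi> a)) (at t)"
    unfolding a_def by (intro field_vector_diff_chain_at)
  then show "((\<lambda>t. f (\<psi> (w + of_real t))) has_vector_derivative
      f (\<psi> (w + of_real t)) * ?q t) (at t)"
    using eq by (simp add: o_def a_def)
qed simp

section \<open>From a conformal conjugacy to an asymptotic path\<close>

lemma limitin_riemann_sphere_None:
  assumes "limitin riemann_sphere (\<lambda>n. Some (p n)) None F"
  shows "filterlim p at_infinity F"
  unfolding filterlim_at_infinity[OF order.refl]
proof (intro allI impI)
  fix b :: real
  define U where "U = insert None (Some ` (UNIV - cball (0::complex) b))"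
  have "openin riemann_sphere U"
    unfolding riemann_sphere_def U_def openin_Alexandroff_compactification
    by (intro disjI2 exI[of _ "cball 0 b"]) auto
  then have "eventually (\<lambda>n. Some (p n) \<in> U) F"
    using assms unfolding limitin_def by (metis U_def insertI1)
  then show "eventually (\<lambda>n. b \<le> norm (p n)) F"
    by eventually_elim (auto simp: U_def)
qed

lemma iterate_unit_translation: "iterate unit_translation n z = Some (z + of_nat n)"
  by (induction n) (auto simp: unit_translation_def add_ac)

text \<open>All three types enter only through a large closed disc in \<open>\<Omega>\<close>. The
  absorbing set \<open>B\<close> swallows a translate of that disc and is invariant under the unit
  translation, so it contains discs of radius \<open>tube_radius\<close> about every point of a
  horizontal ray.\<close>

lemma conjugacy_asymptotic_value:
  assumes f: "f holomorphic_on UNIV"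
    and esc: "\<And>z. z \<in> V \<Longrightarrow> limitin riemann_sphere (\<lambda>n. iterate (newton_map f) n z) None sequentially"
    and conj: "conformal_conjugacy (newton_map f) V \<Omega> \<phi>"
    and sub: "cball c (tube_radius + 1) \<subseteq> \<Omega>"
  shows "asymptotic_value_in f 0 V"
proof -
  let ?N = "newton_map f"
  obtain A where A: "weakly_absorbing ?N V A" "inj_on \<phi> A"
      "weakly_absorbing unit_translation \<Omega> (\<phi> ` A)"
    and hol: "\<phi> holomorphic_on V"
    and semi: "\<And>z. z \<in> V \<Longrightarrow> map_option \<phi> (?N z) = unit_translation (\<phi> z)"
    using conj by (auto simp: conformal_conjugacy_def)
  define B where "B = \<phi> ` A"
  have AV: "A \<subseteq> V" and "open A" and NA: "?N ` A \<subseteq> Some ` A"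
    using A(1) by (auto simp: weakly_absorbing_def)
  have TB: "unit_translation ` B \<subseteq> Some ` B"
    using A(3) by (simp add: weakly_absorbing_def B_def)
  obtain \<psi> where \<psi>: "\<psi> holomorphic_on B" "\<And>z. z \<in> A \<Longrightarrow> \<psi> (\<phi> z) = z"
    using holomorphic_has_inverse[OF holomorphic_on_subset[OF hol AV] \<open>open A\<close> A(2)]
    unfolding B_def by metis
  have inj: "inj_on \<psi> B" using \<psi>(2) by (auto simp: B_def inj_on_def)
  have \<psi>A: "\<psi> u \<in> A" if "u \<in> B" for u using that \<psi>(2) by (auto simp: B_def)
  have step: "u + 1 \<in> B" if "u \<in> B" for u
    using TB that by (auto simp: unit_translation_def)
  have steps: "u + of_nat n \<in> B" if "u \<in> B" for u n
  proof (induction n)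
    case (Suc n)
    then show ?case using step[of "u + of_nat n"] by (simp add: add_ac)
  qed (use that in simp)
  have newton: "?N (\<psi> u) = Some (\<psi> (u + 1))" if "u \<in> B" for u
  proof -
    from \<open>u \<in> B\<close> obtain z where z: "z \<in> A" "u = \<phi> z" unfolding B_def by blast
    obtain z' where z': "z' \<in> A" "?N z = Some z'" using NA z(1) by auto
    have "\<phi> z' = u + 1"
      using semi[of z] z z' AV by (auto simp: unit_translation_def)
    then show ?thesis using z z'(2) \<psi>(2)[OF z(1)] \<psi>(2)[OF z'(1)] by simp
  qed
  have iter: "iterate ?N n (\<psi> u) = Some (\<psi> (u + of_nat n))" if "u \<in> B" for u n
  proof (induction n)
    case (Suc n)
    then show ?case using newton[OF steps[OF that, of n]] by (simp add: add_ac)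
  qed simp
  have "\<exists>k. iterate unit_translation k ` K \<subseteq> Some ` B" if "compact K" "K \<subseteq> \<Omega>" for K
    using A(3) that by (simp add: weakly_absorbing_def B_def)
  \<comment> \<open>The extra 1 in the radius pays for the fractional part of \<open>t\<close>,
    because invariance of \<open>B\<close> gives only integer translates of the disc.\<close>
  then obtain k where k: "iterate unit_translation k ` cball c (tube_radius + 1) \<subseteq> Some ` B"
    using compact_cball sub by metis
  define w where "w = c + of_nat k"
  have ball: "ball (w + of_real t) tube_radius \<subseteq> B" if t: "t \<ge> 0" for t
  proof
    fix z assume z: "z \<in> ball (w + of_real t) tube_radius"
    define n where "n = nat \<lfloor>t\<rfloor>"
    \<comment> \<open>Undoing both integer translations leaves a point whose distance from
      \<open>c\<close> is less than \<open>tube_radius\<close> plus the fractional part of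
      \<open>t\<close>.\<close>
    define y where "y = z - of_nat n - of_nat k"
    have n: "real n = of_int \<lfloor>t\<rfloor>" using t by (simp add: n_def)
    have "y - c = (z - (w + of_real t)) + of_real (t - real n)"
      by (simp add: y_def w_def)
    then have "norm (y - c) \<le> norm (z - (w + of_real t)) + norm (of_real (t - real n) :: complex)"
      by (metis norm_triangle_ineq)
    moreover have "norm (of_real (t - real n) :: complex) \<le> 1"
      unfolding norm_of_real n by linarith
    ultimately have "y \<in> cball c (tube_radius + 1)"
      using z by (simp add: dist_norm norm_minus_commute)
    then have "iterate unit_translation k y \<in> Some ` B" using k by blast
    then have "y + of_nat k \<in> B" by (auto simp: iterate_unit_translation)
    then have "y + of_nat k + of_nat n \<in> B" by (rule steps)
    then show "z \<in> B" by (simp add: y_def)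
  qed
  have wB: "w + of_real t \<in> B" if "t \<ge> 0" for t
    using ball[OF that] tube_radius_gt by auto
  have wB0: "w \<in> B" using wB[of 0] by simp
  \<comment> \<open>The Newton orbit of \<open>\<psi> w\<close> is the sequence of points
    \<open>\<psi> (w + of_nat n)\<close>, so escape in \<open>V\<close> is escape at integer times
    on the ray.\<close>
  have "limitin riemann_sphere (\<lambda>n. Some (\<psi> (w + of_nat n))) None sequentially"
    using esc[of "\<psi> w"] \<psi>A[OF wB0] AV unfolding iter[OF wB0] by blast
  then have lim: "filterlim (\<lambda>n. \<psi> (w + of_nat n)) at_infinity sequentially"
    by (rule limitin_riemann_sphere_None)
  show ?thesis
    unfolding asymptotic_value_in_def
  proof (intro exI conjI)
    show "continuous_on {0<..} (\<lambda>t. \<psi> (w + of_real t))"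
      by (rule continuous_on_compose2[OF holomorphic_on_imp_continuous_on[OF \<psi>(1)]])
         (use wB in \<open>auto intro!: continuous_intros\<close>)
    show "(\<lambda>t. \<psi> (w + of_real t)) ` {0<..} \<subseteq> V"
      using \<psi>A wB AV by force
    show "filterlim (\<lambda>t. \<psi> (w + of_real t)) at_infinity at_top"
      by (rule ray_to_infinity[OF \<psi>(1) inj order.refl ball lim])
    show "((\<lambda>t. f (\<psi> (w + of_real t))) \<longlongrightarrow> 0) at_top"
      by (rule ray_values_to_zero[OF f \<psi>(1) inj order.refl ball newton])
  qed
qed

theorem theorem6p1:
  shows "\<exists>H::real. H > 0 \<and>
    (\<forall>(f :: complex \<Rightarrow> complex) V.
       f holomorphic_on UNIV \<longrightarrow>
       virtual_immediate_basin (newton_map f) V \<longrightarrow>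
       parabolic_type_I (newton_map f) V \<or>
       parabolic_type_II (newton_map f) V \<or>
       (\<exists>h\<ge>H. hyperbolic_with_constant (newton_map f) V h) \<longrightarrow>
       asymptotic_value_in f 0 V)"
proof (intro exI[of _ "tube_radius + 2"] conjI allI impI)
  show "tube_radius + 2 > 0" using tube_radius_gt by simp
next
  fix f :: "complex \<Rightarrow> complex" and V
  assume f: "f holomorphic_on UNIV" and V: "virtual_immediate_basin (newton_map f) V"
    and type: "parabolic_type_I (newton_map f) V \<or> parabolic_type_II (newton_map f) V \<or>
      (\<exists>h\<ge>tube_radius + 2. hyperbolic_with_constant (newton_map f) V h)"
  \<comment> \<open>This fixes the constant \<open>tube_radius + 2\<close>: a disc of radius
    \<open>tube_radius + 1\<close> fits in an open half-plane when its centre is that far from the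
    boundary line, and in an open strip about the real axis of at least that half-height when
    centred at 0.\<close>
  have im: "\<bar>Im z - Im c\<bar> \<le> tube_radius + 1" if "z \<in> cball c (tube_radius + 1)" for z c
    using abs_Im_le_cmod[of "c - z"] that by (simp add: dist_norm abs_minus_commute)
  have "\<exists>\<Omega> \<phi> c. conformal_conjugacy (newton_map f) V \<Omega> \<phi> \<and> cball c (tube_radius + 1) \<subseteq> \<Omega>"
    using type unfolding parabolic_type_I_def parabolic_type_II_def hyperbolic_with_constant_def
  proof (elim disjE exE conjE)
    fix \<phi> assume "conformal_conjugacy (newton_map f) V UNIV \<phi>"
    then show ?thesis by blast
  next
    fix b \<phi> assume "conformal_conjugacy (newton_map f) V {z. Im z > b} \<phi>"
    moreover have "cball (Complex 0 (b + tube_radius + 2)) (tube_radius + 1) \<subseteq> {z. Im z > b}"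
      using im[of _ "Complex 0 (b + tube_radius + 2)"] by fastforce
    ultimately show ?thesis by blast
  next
    fix b \<phi> assume "conformal_conjugacy (newton_map f) V {z. Im z < b} \<phi>"
    moreover have "cball (Complex 0 (b - tube_radius - 2)) (tube_radius + 1) \<subseteq> {z. Im z < b}"
      using im[of _ "Complex 0 (b - tube_radius - 2)"] by fastforce
    ultimately show ?thesis by blast
  next
    fix h \<phi> assume "tube_radius + 2 \<le> h" "conformal_conjugacy (newton_map f) V {z. \<bar>Im z\<bar> < h} \<phi>"
    moreover from this have "cball 0 (tube_radius + 1) \<subseteq> {z. \<bar>Im z\<bar> < h}"
      using im[of _ 0] by fastforce
    ultimately show ?thesis by blast
  qed
  then show "asymptotic_value_in f 0 V"
    using conjugacy_asymptotic_value[OF f] V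
    unfolding virtual_immediate_basin_def escaping_with_absorbing_set_def by blast
qed

end
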